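(* Write $\Theta_n=\{\phi_1,\dots,\phi_s\}$ and let $I,J\subseteq\{1,\dots,s\}$. The rule $r=\frac{\bigvee_{i\in I}\phi_i\vee\bigvee_{j\in J}\phi_j}{\bigvee_{j\in J}\phi_j}$ is inadmissible in $S4$ iff there is a set $W\subseteq\{\phi_i\in\Theta_n\mid i\in I\cup J\}$ such that (1) $\phi_i\in W$ for some $i\in I$; (2) $\mathcal M(\Theta_n,W),\phi_j\models\phi_j$ for all $\phi_j\in W$; (3) for each subset $D$ of $W$ there exists $\phi_j\in W$ such that $\theta_\diamond(\phi_j)=\theta(\phi_j)\cup\bigcup_{\phi\in D}\theta_\diamond(\phi)$.
   Context: $S4$ is the normal modal logic with axioms $K$, $T:\Box A\to A$, $4:\Box A\to\Box\Box A$ and necessitation; $\diamond=\neg\Box\neg$. A substitution $\sigma$ rejects a rule $\frac{\alpha}{\beta}$ if $\vdash_{S4}\sigma(\alpha)$ and $\nvdash_{S4}\sigma(\beta)$; the rule is admissible if no substitution rejects it, inadmissible otherwise. Fix variables $p_1,\dots,p_n$; $\alpha^1=\alpha$, $\alpha^0=\neg\alpha$. $\Theta_n$ is the set of all disjuncts $\bigwedge_{i=1}^n p_i^{t(i,0)}\wedge\bigwedge_{i=1}^n(\diamond p_i)^{t(i,1)}$, $t:\{1,\dots,n\}\times\{0,1\}\to\{0,1\}$. For such $\phi$, $\theta(\phi)=\{p_i\mid t(i,0)=1\}$, $\theta_\diamond(\phi)=\{p_i\mid t(i,1)=1\}$. For $W\subseteq\Theta_n$, $\mathcal M(\Theta_n,W)$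 is the Kripke model with worlds $W$, $\phi R\psi$ iff $\theta_\diamond(\psi)\subseteq\theta_\diamond(\phi)$, and $p_i$ true at $\phi$ iff $p_i\in\theta(\phi)$.
   Formalization: Condition (1) is stated as "φ_i ∈ W for some i ∈ I∖J" instead of "i ∈ I"; for disjoint I and J this is the same, while for overlapping I and J the literal criterion fails (n=1, I=J={1,…,s}, W={p∧◇p, ¬p∧¬◇p}). *)

theory Defs
  imports Main "HOL-Library.FuncSet"
begin

datatype fm = Var nat | Bot | Imp fm fm | Box fm

abbreviation Neg :: "fm \<Rightarrow> fm" where "Neg A \<equiv> Imp A Bot"
abbreviation Top :: fm where "Top \<equiv> Neg Bot"
abbreviation Or :: "fm \<Rightarrow> fm \<Rightarrow> fm" where "Or A B \<equiv> Imp (Neg A) B"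
abbreviation And :: "fm \<Rightarrow> fm \<Rightarrow> fm" where "And A B \<equiv> Neg (Imp A (Neg B))"
abbreviation Dia :: "fm \<Rightarrow> fm" where "Dia A \<equiv> Neg (Box (Neg A))"

definition BigAnd :: "fm list \<Rightarrow> fm" where "BigAnd As = foldr And As Top"
definition BigOr :: "fm list \<Rightarrow> fm" where "BigOr As = foldr Or As Bot"

text \<open>A tautology of the modal language is an instance of a propositional tautology: it holds under
  every truth assignment to variables and boxed formulas, the latter being treated as atoms.\<close>

primrec taut_eval :: "(fm \<Rightarrow> bool) \<Rightarrow> fm \<Rightarrow> bool" where
  "taut_eval e (Var x) = e (Var x)"
| "taut_eval e Bot = False"
| "taut_eval e (Imp A B) = (taut_eval e A \<longrightarrow> taut_eval e B)"
| "taut_eval e (Box A) = e (Box A)"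

definition tautology :: "fm \<Rightarrow> bool" where
  "tautology A \<longleftrightarrow> (\<forall>e. taut_eval e A)"

inductive S4 :: "fm \<Rightarrow> bool" (\<open>\<turnstile>\<^sub>S\<^sub>4 _\<close> [50] 50) where
  Taut: "tautology A \<Longrightarrow> \<turnstile>\<^sub>S\<^sub>4 A"
| AxK: "\<turnstile>\<^sub>S\<^sub>4 Imp (Box (Imp A B)) (Imp (Box A) (Box B))"
| AxT: "\<turnstile>\<^sub>S\<^sub>4 Imp (Box A) A"
| Ax4: "\<turnstile>\<^sub>S\<^sub>4 Imp (Box A) (Box (Box A))"
| MP: "\<turnstile>\<^sub>S\<^sub>4 Imp A B \<Longrightarrow> \<turnstile>\<^sub>S\<^sub>4 A \<Longrightarrow> \<turnstile>\<^sub>S\<^sub>4 B"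
| Nec: "\<turnstile>\<^sub>S\<^sub>4 A \<Longrightarrow> \<turnstile>\<^sub>S\<^sub>4 Box A"

primrec subst :: "(nat \<Rightarrow> fm) \<Rightarrow> fm \<Rightarrow> fm" where
  "subst \<sigma> (Var x) = \<sigma> x"
| "subst \<sigma> Bot = Bot"
| "subst \<sigma> (Imp A B) = Imp (subst \<sigma> A) (subst \<sigma> B)"
| "subst \<sigma> (Box A) = Box (subst \<sigma> A)"

text \<open>The pair \<open>(\<alpha>, \<beta>)\<close> is the rule with premise \<open>\<alpha>\<close> and conclusion \<open>\<beta>\<close>.\<close>

fun rejects :: "(nat \<Rightarrow> fm) \<Rightarrow> fm \<times> fm \<Rightarrow> bool" where
  "rejects \<sigma> (\<alpha>, \<beta>) \<longleftrightarrow> \<turnstile>\<^sub>S\<^sub>4 subst \<sigma> \<alpha> \<and> \<not> \<turnstile>\<^sub>S\<^sub>4 subst \<sigma> \<beta>"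

definition admissible :: "fm \<times> fm \<Rightarrow> bool" where
  "admissible r \<longleftrightarrow> \<not> (\<exists>\<sigma>. rejects \<sigma> r)"

definition inadmissible :: "fm \<times> fm \<Rightarrow> bool" where
  "inadmissible r \<longleftrightarrow> \<not> admissible r"

record 'w kripke_model =
  worlds :: "'w set"
  acc :: "'w \<Rightarrow> 'w \<Rightarrow> bool"
  val :: "'w \<Rightarrow> nat \<Rightarrow> bool"

primrec sat :: "'w kripke_model \<Rightarrow> 'w \<Rightarrow> fm \<Rightarrow> bool" where
  "sat M w (Var x) = val M w x"
| "sat M w Bot = False"
| "sat M w (Imp A B) = (sat M w A \<longrightarrow> sat M w B)"
| "sat M w (Box A) = (\<forall>v\<in>worlds M. acc M w v \<longrightarrow> sat M v A)"

definition signed :: "fm \<Rightarrow> nat \<Rightarrow> fm" where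
  "signed \<alpha> k = (if k = 1 then \<alpha> else Neg \<alpha>)"

definition disjunct :: "nat \<Rightarrow> (nat \<times> nat \<Rightarrow> nat) \<Rightarrow> fm" where
  "disjunct n t =
     And (BigAnd (map (\<lambda>i. signed (Var i) (t (i, 0))) [1..<Suc n]))
         (BigAnd (map (\<lambda>i. signed (Dia (Var i)) (t (i, 1))) [1..<Suc n]))"

definition sign_funs :: "nat \<Rightarrow> (nat \<times> nat \<Rightarrow> nat) set" where
  "sign_funs n = ({1..n} \<times> {0, 1}) \<rightarrow>\<^sub>E {0, 1}"

definition Theta :: "nat \<Rightarrow> fm set" where
  "Theta n = disjunct n ` sign_funs n"

text \<open>Elements of \<open>Theta n\<close> are formulas, so \<open>\<theta>\<close> and \<open>\<theta>\<^sub>\<diamond>\<close> recover the sign function from the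
  formula; it is unique by \<open>inj_on_disjunct\<close> below. The variable \<open>p\<^sub>i\<close> is identified with its
  index \<open>i\<close>.\<close>

definition theta :: "nat \<Rightarrow> fm \<Rightarrow> nat set" where
  "theta n \<phi> = {i \<in> {1..n}. \<exists>t \<in> sign_funs n. \<phi> = disjunct n t \<and> t (i, 0) = 1}"

definition theta_dia :: "nat \<Rightarrow> fm \<Rightarrow> nat set" where
  "theta_dia n \<phi> = {i \<in> {1..n}. \<exists>t \<in> sign_funs n. \<phi> = disjunct n t \<and> t (i, 1) = 1}"

lemma BigAnd_map_eq_iff:
  "BigAnd (map f xs) = BigAnd (map g xs) \<longleftrightarrow> (\<forall>x\<in>set xs. f x = g x)"
  by (induction xs) (auto simp: BigAnd_def)

lemma signed_eq_iff:
  assumes "k \<in> {0, 1}" "l \<in> {0, 1}"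
  shows "signed A k = signed A l \<longleftrightarrow> k = l"
proof -
  have "A \<noteq> Neg A" by (induction A) auto
  then show ?thesis using assms by (auto simp: signed_def)
qed

lemma sign_funs_mem:
  "t \<in> sign_funs n \<Longrightarrow> x \<in> {1..n} \<times> {0, 1} \<Longrightarrow> t x \<in> {0, 1}"
  unfolding sign_funs_def by (rule PiE_mem)

lemma inj_on_disjunct: "inj_on (disjunct n) (sign_funs n)"
proof (rule inj_onI)
  fix t u assume t: "t \<in> sign_funs n" and u: "u \<in> sign_funs n"
    and eq: "disjunct n t = disjunct n u"
  have conj: "BigAnd (map (\<lambda>i. signed (Var i) (t (i, 0))) [1..<Suc n]) =
        BigAnd (map (\<lambda>i. signed (Var i) (u (i, 0))) [1..<Suc n])"
      "BigAnd (map (\<lambda>i. signed (Dia (Var i)) (t (i, 1))) [1..<Suc n]) =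
        BigAnd (map (\<lambda>i. signed (Dia (Var i)) (u (i, 1))) [1..<Suc n])"
    using eq unfolding disjunct_def fm.inject by iprover+
  have "t x = u x" if x: "x \<in> {1..n} \<times> {0, 1}" for x
  proof -
    obtain i k where ik: "x = (i, k)" "i \<in> set [1..<Suc n]" "k = 0 \<or> k = 1"
      using x unfolding atLeastLessThanSuc_atLeastAtMost[symmetric] set_upt[symmetric] by blast
    have mem: "t x \<in> {0, 1}" "u x \<in> {0, 1}"
      using sign_funs_mem[OF t x] sign_funs_mem[OF u x] .
    from ik(3) show ?thesis
    proof
      assume k: "k = 0"
      have "signed (Var i) (t (i, 0)) = signed (Var i) (u (i, 0))"
        using conj(1) ik(2) unfolding BigAnd_map_eq_iff by (rule bspec)
      then show ?thesis using mem unfolding ik(1) k by (simp only: signed_eq_iff)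
    next
      assume k: "k = 1"
      have "signed (Dia (Var i)) (t (i, 1)) = signed (Dia (Var i)) (u (i, 1))"
        using conj(2) ik(2) unfolding BigAnd_map_eq_iff by (rule bspec)
      then show ?thesis using mem unfolding ik(1) k by (simp only: signed_eq_iff)
    qed
  qed
  with t u show "t = u"
    unfolding sign_funs_def by (rule PiE_ext)
qed

lemma theta_disjunct:
  assumes "t \<in> sign_funs n"
  shows "theta n (disjunct n t) = {i \<in> {1..n}. t (i, 0) = 1}"
    and "theta_dia n (disjunct n t) = {i \<in> {1..n}. t (i, 1) = 1}"
proof -
  have "u = t" if "u \<in> sign_funs n" "disjunct n t = disjunct n u" for u
    using inj_onD[OF inj_on_disjunct that(2) assms that(1)] by (rule sym)
  then show "theta n (disjunct n t) = {i \<in> {1..n}. t (i, 0) = 1}"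
    and "theta_dia n (disjunct n t) = {i \<in> {1..n}. t (i, 1) = 1}"
    unfolding theta_def theta_dia_def using assms by blast+
qed

definition model_Theta :: "nat \<Rightarrow> fm set \<Rightarrow> fm kripke_model" where
  "model_Theta n W =
     \<lparr>worlds = W,
      acc = (\<lambda>\<phi> \<psi>. theta_dia n \<psi> \<subseteq> theta_dia n \<phi>),
      val = (\<lambda>\<phi> i. i \<in> theta n \<phi>)\<rparr>"

definition disj_over :: "(nat \<Rightarrow> fm) \<Rightarrow> nat set \<Rightarrow> fm" where
  "disj_over \<phi> I = BigOr (map \<phi> (sorted_list_of_set I))"

text \<open>The rule displays the disjuncts indexed by \<open>I\<close> as those of the premise that are missing
  from the conclusion, which presupposes \<open>I \<inter> J = {}\<close>. If overlapping index sets are allowed,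
  condition (1) of the criterion has to ask for a member of \<open>W\<close> indexed by \<open>I - J\<close>: for
  \<open>I = J = {1..s}\<close> the rule \<open>\<alpha>/\<alpha>\<close> is admissible, although for \<open>n = 1\<close> the set consisting of
  \<open>p \<and> \<diamond>p\<close> and \<open>\<not>p \<and> \<not>\<diamond>p\<close> meets (2), (3) and contains elements indexed by \<open>I\<close>. For disjoint
  \<open>I\<close> and \<open>J\<close>, \<open>I - J\<close> is just \<open>I\<close>.\<close>

definition rule_IJ :: "(nat \<Rightarrow> fm) \<Rightarrow> nat set \<Rightarrow> nat set \<Rightarrow> fm \<times> fm" where
  "rule_IJ \<phi> I J = (Or (disj_over \<phi> I) (disj_over \<phi> J), disj_over \<phi> J)"

end

theory Submission
  imports Defs
begin

text \<open>
  If \<open>\<sigma>\<close> rejects the rule, take for \<open>W\<close> the disjuncts whose \<open>\<sigma>\<close>-instances are satisfiable;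
  condition (3) holds because a reflexive root can be added below any set of worlds of the
  canonical model. Conversely, let \<open>\<alpha>\<close> be the disjunction of \<open>W\<close>, and for each world \<open>w\<close> let
  \<open>U w\<close> be the set of those \<open>j\<close> for which \<open>w\<close> satisfies \<open>\<diamond>(\<box>\<alpha> \<and> p\<^sub>j)\<close>. Consider the substitution
  that keeps the variables at worlds satisfying \<open>\<box>\<alpha>\<close> and gives any other world \<open>w\<close> the valuation
  of a \<open>\<psi> \<in> W\<close> with \<open>\<theta>\<^sub>\<diamond> \<psi> = \<theta> \<psi> \<union> U w\<close>, which exists by (3). After \<open>k\<close> iterations
  every world refuting \<open>\<box>\<alpha>\<close> has at least \<open>k\<close> elements in \<open>U w\<close>: a world with exactly \<open>k\<close> elements
  sees, apart from worlds satisfying \<open>\<box>\<alpha>\<close>, only worlds with the same set \<open>U\<close>, so that the next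
  iteration makes \<open>\<box>\<alpha>\<close> true there. Hence \<open>n + 1\<close> iterations make \<open>\<alpha>\<close> valid, while by (2) they
  change nothing on \<open>\<M>(\<Theta>\<^sub>n, W)\<close>.\<close>

section \<open>Soundness and completeness of S4\<close>

definition s4_model :: "'w kripke_model \<Rightarrow> bool" where
  "s4_model M \<longleftrightarrow> (\<forall>w\<in>worlds M. acc M w w) \<and>
     (\<forall>u\<in>worlds M. \<forall>v\<in>worlds M. \<forall>w\<in>worlds M. acc M u v \<longrightarrow> acc M v w \<longrightarrow> acc M u w)"

lemma s4_model_refl: "s4_model M \<Longrightarrow> w \<in> worlds M \<Longrightarrow> acc M w w"
  by (simp add: s4_model_def)

lemma s4_model_trans:
  "s4_model M \<Longrightarrow> u \<in> worlds M \<Longrightarrow> v \<in> worlds M \<Longrightarrow> w \<in> worlds M \<Longrightarrow>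
    acc M u v \<Longrightarrow> acc M v w \<Longrightarrow> acc M u w"
  unfolding s4_model_def by blast

lemma taut_eval_sat: "taut_eval (sat M w) A = sat M w A"
  by (induction A) auto

lemma S4_sound: "\<turnstile>\<^sub>S\<^sub>4 A \<Longrightarrow> s4_model M \<Longrightarrow> w \<in> worlds M \<Longrightarrow> sat M w A"
proof (induction arbitrary: w rule: S4.induct)
  case (Taut A)
  then show ?case unfolding tautology_def by (metis taut_eval_sat)
next
  case (AxT A)
  then show ?case by (auto dest: s4_model_refl)
next
  case (Ax4 A)
  then show ?case by (auto intro: s4_model_trans)
qed auto

lemma taut_eval_foldr_Imp:
  "taut_eval e (foldr Imp As A) \<longleftrightarrow> ((\<forall>B\<in>set As. taut_eval e B) \<longrightarrow> taut_eval e A)"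
  by (induction As) auto

lemma S4_taut_MP: "\<turnstile>\<^sub>S\<^sub>4 A \<Longrightarrow> (\<And>e. taut_eval e A \<Longrightarrow> taut_eval e B) \<Longrightarrow> \<turnstile>\<^sub>S\<^sub>4 B"
  by (rule S4.MP[OF S4.Taut]) (auto simp: tautology_def)

lemma S4_taut_MP2:
  assumes "\<turnstile>\<^sub>S\<^sub>4 A" "\<turnstile>\<^sub>S\<^sub>4 B" "\<And>e. taut_eval e A \<Longrightarrow> taut_eval e B \<Longrightarrow> taut_eval e C"
  shows "\<turnstile>\<^sub>S\<^sub>4 C"
proof -
  have "\<turnstile>\<^sub>S\<^sub>4 Imp A (Imp B C)" using assms(3) by (intro S4.Taut) (simp add: tautology_def)
  from S4.MP[OF S4.MP[OF this assms(1)] assms(2)] show ?thesis .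
qed

section \<open>Derivability from sets of formulas and maximal consistent sets\<close>

definition derives :: "fm set \<Rightarrow> fm \<Rightarrow> bool" where
  "derives S A \<longleftrightarrow> (\<exists>As. set As \<subseteq> S \<and> \<turnstile>\<^sub>S\<^sub>4 foldr Imp As A)"

lemma derives_S4: "\<turnstile>\<^sub>S\<^sub>4 A \<Longrightarrow> derives S A"
  unfolding derives_def by (rule exI[of _ "[]"]) simp

lemma derives_mem: "A \<in> S \<Longrightarrow> derives S A"
  unfolding derives_def by (rule exI[of _ "[A]"]) (auto intro: S4.Taut simp: tautology_def)

lemma derives_taut:
  assumes "derives S A" "derives S B" "\<And>e. taut_eval e A \<Longrightarrow> taut_eval e B \<Longrightarrow> taut_eval e C"
  shows "derives S C"
proof -
  obtain As Bs where AB: "set As \<subseteq> S" "\<turnstile>\<^sub>S\<^sub>4 foldr Imp As A" "set Bs \<subseteq> S" "\<turnstile>\<^sub>S\<^sub>4 foldr Imp Bs B"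
    using assms(1,2) unfolding derives_def by blast
  have "\<turnstile>\<^sub>S\<^sub>4 foldr Imp (As @ Bs) C"
    using assms(3)
    by (intro S4_taut_MP2[OF AB(2,4)]) (auto simp: taut_eval_foldr_Imp simp del: foldr_append)
  with AB(1,3) show ?thesis
    unfolding derives_def by (intro exI[of _ "As @ Bs"]) auto
qed

text \<open>The deduction theorem. \<open>derives\<close> rests on a theorem with finitely many
  members of the set as antecedents, so necessitation never touches a premise, and collecting the
  occurrences of \<open>A\<close> into one antecedent is propositional.\<close>

lemma derives_insert:
  assumes "derives (insert A S) B" shows "derives S (Imp A B)"
proof -
  obtain As where As: "set As \<subseteq> insert A S" "\<turnstile>\<^sub>S\<^sub>4 foldr Imp As B"
    using assms unfolding derives_def by blast
  have "\<turnstile>\<^sub>S\<^sub>4 foldr Imp (filter (\<lambda>C. C \<noteq> A) As) (Imp A B)"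
    using As(2) by (rule S4_taut_MP) (auto simp: taut_eval_foldr_Imp)
  with As(1) show ?thesis
    unfolding derives_def by (intro exI[of _ "filter (\<lambda>C. C \<noteq> A) As"]) auto
qed

definition mcs :: "fm set \<Rightarrow> bool" where
  "mcs S \<longleftrightarrow> \<not> derives S Bot \<and> (\<forall>T. S \<subseteq> T \<longrightarrow> \<not> derives T Bot \<longrightarrow> T = S)"

lemma lindenbaum:
  assumes "\<not> derives S Bot" shows "\<exists>T. mcs T \<and> S \<subseteq> T"
proof -
  define C where "C = {T. S \<subseteq> T \<and> \<not> derives T Bot}"
  have "\<exists>M\<in>C. \<forall>X\<in>C. M \<subseteq> X \<longrightarrow> X = M"
  proof (rule subset_Zorn_nonempty)
    show "C \<noteq> {}" using assms by (auto simp: C_def)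
  next
    fix \<C> assume ne: "\<C> \<noteq> {}" and ch: "subset.chain C \<C>"
    have sub: "\<C> \<subseteq> C" using ch by (simp add: subset_chain_def)
    \<comment> \<open>A derivation uses finitely many premises, and these already lie in one member
      of the chain.\<close>
    have "\<not> derives (\<Union>\<C>) Bot"
    proof
      assume "derives (\<Union>\<C>) Bot"
      then obtain As where As: "set As \<subseteq> \<Union>\<C>" "\<turnstile>\<^sub>S\<^sub>4 foldr Imp As Bot"
        unfolding derives_def by blast
      obtain T where T: "T \<in> \<C>" "set As \<subseteq> T"
        using finite_subset_Union_chain[OF finite_set As(1) ne ch] .
      then have "derives T Bot" using As(2) unfolding derives_def by blast
      moreover have "T \<in> C" using T(1) sub by (rule rev_subsetD)
      ultimately show False by (simp add: C_def)
    qed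
    moreover have "S \<subseteq> \<Union>\<C>"
    proof -
      obtain T where "T \<in> \<C>" using ne by blast
      with sub have "S \<subseteq> T" by (auto simp: C_def)
      with \<open>T \<in> \<C>\<close> show ?thesis by blast
    qed
    ultimately show "\<Union>\<C> \<in> C" by (simp add: C_def)
  qed
  then obtain M where M: "M \<in> C" "\<forall>X\<in>C. M \<subseteq> X \<longrightarrow> X = M" ..
  then have "mcs M" unfolding mcs_def C_def by simp blast
  with M(1) show ?thesis by (auto simp: C_def)
qed

lemma mcs_derives: assumes "mcs S" "derives S A" shows "A \<in> S"
proof (rule ccontr)
  assume "A \<notin> S"
  then have "derives (insert A S) Bot" using assms(1) unfolding mcs_def by blast
  then have "derives S Bot"
    by (rule derives_taut[OF derives_insert assms(2)]) simp
  then show False using assms(1) unfolding mcs_def by blast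
qed

lemma mcs_Bot: "mcs S \<Longrightarrow> Bot \<notin> S"
  unfolding mcs_def using derives_mem by blast

lemma mcs_Imp:
  assumes "mcs S" shows "Imp A B \<in> S \<longleftrightarrow> (A \<in> S \<longrightarrow> B \<in> S)"
proof
  assume *: "Imp A B \<in> S"
  show "A \<in> S \<longrightarrow> B \<in> S"
  proof
    assume "A \<in> S"
    have "derives S B" by (rule derives_taut[OF derives_mem[OF *] derives_mem[OF \<open>A \<in> S\<close>]]) simp
    then show "B \<in> S" by (rule mcs_derives[OF assms])
  qed
next
  assume *: "A \<in> S \<longrightarrow> B \<in> S"
  have "derives S (Imp A B)"
  proof (cases "A \<in> S")
    case True
    with * have "derives S B" using derives_mem by blast
    then show ?thesis by (rule derives_taut[OF _ \<open>derives S B\<close>]) simp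
  next
    case False
    then have "derives (insert A S) Bot" using assms unfolding mcs_def by blast
    then have "derives S (Neg A)" by (rule derives_insert)
    then show ?thesis by (rule derives_taut[OF _ \<open>derives S (Neg A)\<close>]) auto
  qed
  then show "Imp A B \<in> S" by (rule mcs_derives[OF assms])
qed

lemma S4_Box_foldr_Imp: "\<turnstile>\<^sub>S\<^sub>4 Imp (Box (foldr Imp As A)) (foldr Imp (map Box As) (Box A))"
proof (induction As)
  case Nil
  show ?case by (auto intro: S4.Taut simp: tautology_def)
next
  case (Cons B As)
  show ?case
    by (rule S4_taut_MP2[OF Cons.IH S4.AxK[of B "foldr Imp As A"]]) auto
qed

text \<open>If \<open>Neg A\<close> were inconsistent with the unboxed formulas of \<open>S\<close>,
  these would derive \<open>A\<close>; boxing that derivation by K and necessitation would put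
  \<open>Box A\<close> into \<open>S\<close>.\<close>

lemma mcs_Box_successor:
  assumes "mcs S" "Box A \<notin> S"
  shows "\<exists>T. mcs T \<and> (\<forall>B. Box B \<in> S \<longrightarrow> B \<in> T) \<and> A \<notin> T"
proof -
  let ?S = "{B. Box B \<in> S}"
  have "\<not> derives (insert (Neg A) ?S) Bot"
  proof
    assume "derives (insert (Neg A) ?S) Bot"
    then have "derives ?S (Neg (Neg A))" by (rule derives_insert)
    then have "derives ?S A" by (rule derives_taut[OF _ \<open>derives ?S (Neg (Neg A))\<close>]) auto
    then obtain As where As: "set As \<subseteq> ?S" "\<turnstile>\<^sub>S\<^sub>4 foldr Imp As A" unfolding derives_def by blast
    have "\<turnstile>\<^sub>S\<^sub>4 foldr Imp (map Box As) (Box A)"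
      by (rule S4.MP[OF S4_Box_foldr_Imp S4.Nec[OF As(2)]])
    with As(1) have "derives S (Box A)"
      unfolding derives_def by (intro exI[of _ "map Box As"]) auto
    with assms show False by (simp add: mcs_derives)
  qed
  from lindenbaum[OF this] obtain T where T: "mcs T" "insert (Neg A) ?S \<subseteq> T" by blast
  then have "A \<notin> T" using mcs_Imp[OF T(1), of A Bot] mcs_Bot by blast
  with T show ?thesis by blast
qed

section \<open>The canonical model and completeness\<close>

definition canonical :: "fm set kripke_model" where
  "canonical = \<lparr>worlds = {S. mcs S}, acc = (\<lambda>S T. \<forall>A. Box A \<in> S \<longrightarrow> A \<in> T),
     val = (\<lambda>S i. Var i \<in> S)\<rparr>"

lemma s4_model_canonical: "s4_model canonical"
proof -
  \<comment> \<open>Axiom T gives reflexivity of the canonical relation, and axiom 4, used in the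
    next fact, gives transitivity.\<close>
  have 1: "A \<in> S" if "mcs S" "Box A \<in> S" for A S
    using mcs_derives[OF that(1) derives_S4[OF S4.AxT[of A]]] that by (simp add: mcs_Imp)
  have 2: "Box (Box A) \<in> S" if "mcs S" "Box A \<in> S" for A S
    using mcs_derives[OF that(1) derives_S4[OF S4.Ax4[of A]]] that by (simp add: mcs_Imp)
  show ?thesis
    unfolding s4_model_def canonical_def kripke_model.simps
  proof (intro conjI ballI impI)
    fix S assume "S \<in> {S. mcs S}"
    then show "\<forall>A. Box A \<in> S \<longrightarrow> A \<in> S" by (simp add: 1)
  next
    fix S T U assume "S \<in> {S. mcs S}" "\<forall>A. Box A \<in> S \<longrightarrow> A \<in> T" "\<forall>A. Box A \<in> T \<longrightarrow> A \<in> U"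
    then show "\<forall>A. Box A \<in> S \<longrightarrow> A \<in> U" by (simp add: 2)
  qed
qed

lemma sat_canonical: "mcs S \<Longrightarrow> sat canonical S A \<longleftrightarrow> A \<in> S"
proof (induction A arbitrary: S)
  case (Box A)
  have "sat canonical S (Box A) \<longleftrightarrow> (\<forall>T. mcs T \<longrightarrow> (\<forall>B. Box B \<in> S \<longrightarrow> B \<in> T) \<longrightarrow> A \<in> T)"
    using Box.IH by (simp add: canonical_def)
  also have "\<dots> \<longleftrightarrow> Box A \<in> S" using mcs_Box_successor[OF Box.prems] by blast
  finally show ?case .
qed (simp_all add: canonical_def mcs_Imp mcs_Bot)

lemma S4_complete:
  assumes "\<And>w. w \<in> worlds canonical \<Longrightarrow> sat canonical w A"
  shows "\<turnstile>\<^sub>S\<^sub>4 A"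
proof (rule ccontr)
  assume not: "\<not> \<turnstile>\<^sub>S\<^sub>4 A"
  have "\<not> derives {Neg A} Bot"
  proof
    assume "derives {Neg A} Bot"
    then have "derives {} (Neg (Neg A))" by (rule derives_insert)
    then have "\<turnstile>\<^sub>S\<^sub>4 Neg (Neg A)" unfolding derives_def by simp
    then have "\<turnstile>\<^sub>S\<^sub>4 A" by (rule S4_taut_MP) auto
    with not show False ..
  qed
  from lindenbaum[OF this] obtain T where T: "mcs T" "Neg A \<in> T" by blast
  moreover have "A \<in> T" using assms[of T] sat_canonical[OF T(1)] T(1) by (simp add: canonical_def)
  ultimately show False by (simp add: mcs_Imp mcs_Bot)
qed

section \<open>Substitutions and disjuncts in models\<close>

text \<open>Moves a substitution from the formula into the valuation, as \<open>sat_subst\<close>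
  makes precise. Substitutions thereby act on models and can be iterated there.\<close>

definition subst_model :: "'w kripke_model \<Rightarrow> (nat \<Rightarrow> fm) \<Rightarrow> 'w kripke_model" where
  "subst_model M \<sigma> = M\<lparr>val := \<lambda>w i. sat M w (\<sigma> i)\<rparr>"

lemma subst_model_simps [simp]:
  "worlds (subst_model M \<sigma>) = worlds M"
  "acc (subst_model M \<sigma>) = acc M"
  "val (subst_model M \<sigma>) w i = sat M w (\<sigma> i)"
  by (simp_all add: subst_model_def)

lemma s4_model_subst_model [simp]: "s4_model (subst_model M \<sigma>) = s4_model M"
  by (simp add: s4_model_def)

lemma iterated_subst_model_simps [simp]:
  "worlds (((\<lambda>M. subst_model M \<sigma>) ^^ k) M) = worlds M"
  "s4_model (((\<lambda>M. subst_model M \<sigma>) ^^ k) M) = s4_model M"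
  by (induction k) simp_all

lemma sat_subst: "sat M w (subst \<sigma> A) = sat (subst_model M \<sigma>) w A"
  by (induction A arbitrary: w) auto

section \<open>Disjuncts as descriptions of worlds\<close>

lemma sat_BigAnd: "sat M w (BigAnd As) \<longleftrightarrow> (\<forall>A\<in>set As. sat M w A)"
  by (induction As) (auto simp: BigAnd_def)

lemma sat_BigOr: "sat M w (BigOr As) \<longleftrightarrow> (\<exists>A\<in>set As. sat M w A)"
  by (induction As) (auto simp: BigOr_def)

lemma sat_disj_over: "finite I \<Longrightarrow> sat M w (disj_over \<phi> I) \<longleftrightarrow> (\<exists>i\<in>I. sat M w (\<phi> i))"
  by (simp add: disj_over_def sat_BigOr)

lemma theta_subset: "theta n \<psi> \<subseteq> {1..n}" and theta_dia_subset: "theta_dia n \<psi> \<subseteq> {1..n}"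
  by (auto simp: theta_def theta_dia_def)

lemma set_upt_Suc: "set [m..<Suc n] = {m..n}"
  by (simp only: set_upt atLeastLessThanSuc_atLeastAtMost)

lemma sat_signed: "sat M w (signed A k) \<longleftrightarrow> (k = 1 \<longleftrightarrow> sat M w A)"
  by (simp add: signed_def)

text \<open>Each of the \<open>n\<close> variables occurs in a disjunct with a sign, both plain and
  under a diamond. Truth of a disjunct therefore amounts to two equations between index sets, and
  later arguments work with these sets only.\<close>

lemma sat_Theta:
  assumes "\<psi> \<in> Theta n"
  shows "sat M w \<psi> \<longleftrightarrow> theta n \<psi> = {i \<in> {1..n}. val M w i} \<and>
    theta_dia n \<psi> = {i \<in> {1..n}. \<exists>v\<in>worlds M. acc M w v \<and> val M v i}"
proof -
  obtain t where t: "t \<in> sign_funs n" "\<psi> = disjunct n t" using assms by (auto simp: Theta_def)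
  have "sat M w \<psi> \<longleftrightarrow> (\<forall>i\<in>{1..n}. t (i, 0) = 1 \<longleftrightarrow> val M w i) \<and>
      (\<forall>i\<in>{1..n}. t (i, 1) = 1 \<longleftrightarrow> (\<exists>v\<in>worlds M. acc M w v \<and> val M v i))"
    by (simp add: t(2) disjunct_def sat_BigAnd sat_signed set_upt_Suc del: upt_Suc set_upt)
  moreover have "{x \<in> A. P x} = {x \<in> A. Q x} \<longleftrightarrow> (\<forall>x\<in>A. P x \<longleftrightarrow> Q x)" for A :: "nat set" and P Q
    by blast
  ultimately show ?thesis by (simp only: t(2) theta_disjunct[OF t(1)])
qed

lemma Theta_eqI:
  assumes "\<psi> \<in> Theta n" "\<chi> \<in> Theta n" "theta n \<psi> = theta n \<chi>" "theta_dia n \<psi> = theta_dia n \<chi>"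
  shows "\<psi> = \<chi>"
proof -
  obtain t u where t: "t \<in> sign_funs n" "\<psi> = disjunct n t" and u: "u \<in> sign_funs n" "\<chi> = disjunct n u"
    using assms(1,2) by (auto simp: Theta_def)
  have "t (i, k) = u (i, k)" if ik: "(i, k) \<in> {1..n} \<times> {0, 1}" for i k
  proof -
    have i: "i \<in> {1..n}" and k: "k = 0 \<or> k = 1" using ik by auto
    have "i \<in> theta n \<psi> \<longleftrightarrow> i \<in> theta n \<chi>" "i \<in> theta_dia n \<psi> \<longleftrightarrow> i \<in> theta_dia n \<chi>"
      using assms(3,4) by simp_all
    then have "t (i, k) = 1 \<longleftrightarrow> u (i, k) = 1"
      using i k unfolding t(2) u(2) theta_disjunct[OF t(1)] theta_disjunct[OF u(1)] by auto
    then show ?thesis using sign_funs_mem[OF t(1) ik] sign_funs_mem[OF u(1) ik] by auto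
  qed
  then have "t = u"
    using t(1) u(1) unfolding sign_funs_def by (intro PiE_ext) auto
  then show ?thesis using t(2) u(2) by simp
qed

lemma theta_of_sat:
  assumes "\<psi> \<in> Theta n" "sat M w \<psi>"
  shows "theta n \<psi> = {i \<in> {1..n}. val M w i}"
    and "theta_dia n \<psi> = {i \<in> {1..n}. \<exists>v\<in>worlds M. acc M w v \<and> val M v i}"
  using assms(2) by (simp_all only: sat_Theta[OF assms(1)])

lemma theta_of_sat_subst:
  assumes "\<psi> \<in> Theta n" "sat M w (subst \<sigma> \<psi>)"
  shows "theta n \<psi> = {i \<in> {1..n}. sat M w (\<sigma> i)}"
    and "theta_dia n \<psi> = {i \<in> {1..n}. \<exists>v\<in>worlds M. acc M w v \<and> sat M v (\<sigma> i)}"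
  using theta_of_sat[OF assms(1) assms(2)[unfolded sat_subst]] by (simp_all only: subst_model_simps)

lemma sat_Theta_unique:
  "\<psi> \<in> Theta n \<Longrightarrow> \<chi> \<in> Theta n \<Longrightarrow> sat M w \<psi> \<Longrightarrow> sat M w \<chi> \<Longrightarrow> \<psi> = \<chi>"
  by (rule Theta_eqI[of _ n]) (simp_all only: sat_Theta)

section \<open>From a rejecting substitution to W\<close>

text \<open>\<open>None\<close> is the new root. It sees the successors of members of
  \<open>E\<close>, not just \<open>E\<close>, so that transitivity survives; no old world sees it,
  so truth at old worlds does not change.\<close>

definition add_root :: "'w kripke_model \<Rightarrow> 'w set \<Rightarrow> 'w option kripke_model" where
  "add_root M E = \<lparr>worlds = insert None (Some ` worlds M),
     acc = (\<lambda>x y. case (x, y) of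
        (None, None) \<Rightarrow> True
      | (None, Some v) \<Rightarrow> (\<exists>u\<in>E. acc M u v)
      | (Some u, None) \<Rightarrow> False
      | (Some u, Some v) \<Rightarrow> acc M u v),
     val = (\<lambda>x i. case x of None \<Rightarrow> False | Some w \<Rightarrow> val M w i)\<rparr>"

lemma add_root_simps [simp]:
  "worlds (add_root M E) = insert None (Some ` worlds M)"
  "acc (add_root M E) None None"
  "acc (add_root M E) None (Some v) \<longleftrightarrow> (\<exists>u\<in>E. acc M u v)"
  "\<not> acc (add_root M E) (Some u) None"
  "acc (add_root M E) (Some u) (Some v) = acc M u v"
  "val (add_root M E) (Some w) i = val M w i"
  by (simp_all add: add_root_def)

lemma s4_model_add_root:
  assumes M: "s4_model M" and E: "E \<subseteq> worlds M"
  shows "s4_model (add_root M E)"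
  unfolding s4_model_def
proof (intro conjI ballI impI)
  fix x assume "x \<in> worlds (add_root M E)"
  then show "acc (add_root M E) x x" using s4_model_refl[OF M] by (cases x) auto
next
  fix x y z
  assume "x \<in> worlds (add_root M E)" "y \<in> worlds (add_root M E)" "z \<in> worlds (add_root M E)"
    and "acc (add_root M E) x y" "acc (add_root M E) y z"
  then consider "x = None" "z = None" | "x = y"
    | b c where "x = None" "y = Some b" "z = Some c" "b \<in> worlds M" "c \<in> worlds M"
      "\<exists>u\<in>E. acc M u b" "acc M b c"
    | a b c where "x = Some a" "y = Some b" "z = Some c" "a \<in> worlds M" "b \<in> worlds M" "c \<in> worlds M"
      "acc M a b" "acc M b c"
    by (cases x; cases y; cases z) auto
  then show "acc (add_root M E) x z"
  proof cases
    case 2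
    with \<open>acc (add_root M E) y z\<close> show ?thesis by simp
  next
    case 3
    then obtain u where u: "u \<in> E" "acc M u b" by blast
    with E have "acc M u c" using 3 s4_model_trans[OF M, of u b c] by blast
    with u(1) 3 show ?thesis by auto
  next
    case 4
    then show ?thesis using s4_model_trans[OF M, of a b c] by simp
  qed simp
qed

lemma sat_add_root: "sat (add_root M E) (Some w) A = sat M w A"
  by (induction A arbitrary: w) simp_all

text \<open>Prepares condition (3). The root is placed below one realizing world for each member of
  \<open>D\<close>. A variable is possible at the root iff it holds there or is possible from one of
  these worlds, and the latter is recorded in \<open>theta_dia\<close> of the member realized
  there.\<close>

lemma realized_root_extension:
  fixes M :: "'w kripke_model"
  assumes M: "s4_model M" and DT: "D \<subseteq> Theta n"
    and real: "\<And>\<chi>. \<chi> \<in> D \<Longrightarrow> \<exists>w\<in>worlds M. sat M w (subst \<sigma> \<chi>)"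
  obtains N :: "'w option kripke_model" and r where "s4_model N" "r \<in> worlds N"
    "\<And>\<psi>. \<psi> \<in> Theta n \<Longrightarrow> sat N r (subst \<sigma> \<psi>) \<Longrightarrow>
      theta_dia n \<psi> = theta n \<psi> \<union> (\<Union>\<chi>\<in>D. theta_dia n \<chi>)"
proof -
  obtain f where f: "\<And>\<chi>. \<chi> \<in> D \<Longrightarrow> f \<chi> \<in> worlds M \<and> sat M (f \<chi>) (subst \<sigma> \<chi>)"
    using real by metis
  let ?N = "add_root M (f ` D)"
  have sub: "f ` D \<subseteq> worlds M" using f by auto
  have th: "theta_dia n \<chi> = {i \<in> {1..n}. \<exists>v\<in>worlds M. acc M (f \<chi>) v \<and> sat M v (\<sigma> i)}" if "\<chi> \<in> D" for \<chi>
    using f[OF that] DT that by (intro theta_of_sat_subst) auto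
  have "theta_dia n \<psi> = theta n \<psi> \<union> (\<Union>\<chi>\<in>D. theta_dia n \<chi>)"
    if "\<psi> \<in> Theta n" and s: "sat ?N None (subst \<sigma> \<psi>)" for \<psi>
  proof -
    have "theta n \<psi> = {i \<in> {1..n}. sat ?N None (\<sigma> i)}"
      "theta_dia n \<psi> = {i \<in> {1..n}. sat ?N None (\<sigma> i) \<or> (\<exists>v\<in>worlds M. (\<exists>\<chi>\<in>D. acc M (f \<chi>) v) \<and> sat M v (\<sigma> i))}"
      using theta_of_sat_subst[OF that(1) s] by (simp_all add: sat_add_root)
    moreover have "(\<Union>\<chi>\<in>D. theta_dia n \<chi>) = {i \<in> {1..n}. \<exists>v\<in>worlds M. (\<exists>\<chi>\<in>D. acc M (f \<chi>) v) \<and> sat M v (\<sigma> i)}"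
      using th by auto
    ultimately show ?thesis by auto
  qed
  moreover have "s4_model ?N" "None \<in> worlds ?N"
    using s4_model_add_root[OF M sub] by (auto simp: add_root_def)
  ultimately show ?thesis using that by blast
qed

lemma rejects_imp_criterion:
  assumes enum: "bij_betw \<phi> {1..s} (Theta n)"
    and I: "I \<subseteq> {1..s}" and J: "J \<subseteq> {1..s}"
    and rej: "rejects \<sigma> (rule_IJ \<phi> I J)"
  shows "\<exists>W. W \<subseteq> {\<phi> i | i. i \<in> I \<union> J} \<and>
       (\<exists>i \<in> I - J. \<phi> i \<in> W) \<and>
       (\<forall>\<psi> \<in> W. sat (model_Theta n W) \<psi> \<psi>) \<and>
       (\<forall>D. D \<subseteq> W \<longrightarrow>
          (\<exists>\<psi> \<in> W. theta_dia n \<psi> = theta n \<psi> \<union> (\<Union>\<chi>\<in>D. theta_dia n \<chi>)))"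
proof -
  let ?C = "canonical"
  have fin: "finite I" "finite J" using I J finite_subset by blast+
  have Th: "\<phi> i \<in> Theta n" if "i \<in> I \<union> J" for i
    using enum that I J by (auto simp: bij_betw_def)
  have prem: "\<turnstile>\<^sub>S\<^sub>4 subst \<sigma> (Or (disj_over \<phi> I) (disj_over \<phi> J))"
    and conc: "\<not> \<turnstile>\<^sub>S\<^sub>4 subst \<sigma> (disj_over \<phi> J)"
    using rej by (simp_all add: rule_IJ_def)
  \<comment> \<open>Soundness is applied to the premise in an arbitrary S4 model, because both the
    canonical model and its extension by a root are needed.\<close>
  have cover: "\<exists>i\<in>I \<union> J. sat N w (subst \<sigma> (\<phi> i))" if "s4_model N" "w \<in> worlds N"
    for N :: "'w kripke_model" and w
    using S4_sound[OF prem that] fin unfolding sat_subst by (auto simp: sat_disj_over)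
  define W where "W = {\<psi> \<in> Theta n. \<exists>w\<in>worlds ?C. sat ?C w (subst \<sigma> \<psi>)}"
  \<comment> \<open>Completeness brings satisfiability in any S4 model back to the canonical model,
    whatever the type of worlds.\<close>
  have W_I: "\<psi> \<in> W" if "\<psi> \<in> Theta n" "s4_model N" "w \<in> worlds N" "sat N w (subst \<sigma> \<psi>)"
    for \<psi> w and N :: "'w kripke_model"
  proof -
    have "\<not> \<turnstile>\<^sub>S\<^sub>4 Neg (subst \<sigma> \<psi>)" using S4_sound[OF _ that(2,3)] that(4) by fastforce
    then show ?thesis using S4_complete[of "Neg (subst \<sigma> \<psi>)"] that(1) unfolding W_def by auto
  qed
  have sub: "W \<subseteq> {\<phi> i | i. i \<in> I \<union> J}"
  proof
    fix \<psi> assume "\<psi> \<in> W"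
    then obtain w where w: "\<psi> \<in> Theta n" "w \<in> worlds ?C" "sat ?C w (subst \<sigma> \<psi>)"
      unfolding W_def by blast
    obtain i where i: "i \<in> I \<union> J" "sat ?C w (subst \<sigma> (\<phi> i))"
      using cover[OF s4_model_canonical w(2)] by blast
    have "\<psi> = \<phi> i"
      using w(3) i(2) unfolding sat_subst by (rule sat_Theta_unique[OF w(1) Th[OF i(1)]])
    with i(1) show "\<psi> \<in> {\<phi> i | i. i \<in> I \<union> J}" by blast
  qed
  have "\<exists>i \<in> I - J. \<phi> i \<in> W"
  proof -
    \<comment> \<open>A world refuting the conclusion satisfies the premise, hence a disjunct whose
      index lies outside \<open>J\<close>.\<close>
    obtain w where w: "w \<in> worlds ?C" "\<not> sat ?C w (subst \<sigma> (disj_over \<phi> J))"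
      using S4_complete conc by blast
    obtain i where i: "i \<in> I \<union> J" "sat ?C w (subst \<sigma> (\<phi> i))"
      using cover[OF s4_model_canonical w(1)] by blast
    have "i \<notin> J" using w(2) i(2) fin unfolding sat_subst by (auto simp: sat_disj_over)
    moreover have "\<phi> i \<in> W" by (rule W_I[OF Th[OF i(1)] s4_model_canonical w(1) i(2)])
    ultimately show ?thesis using i(1) by blast
  qed
  moreover have "sat (model_Theta n W) \<psi> \<psi>" if \<psi>W: "\<psi> \<in> W" for \<psi>
  proof -
    obtain w where w: "\<psi> \<in> Theta n" "w \<in> worlds ?C" "sat ?C w (subst \<sigma> \<psi>)"
      using \<psi>W unfolding W_def by blast
    note td = theta_of_sat_subst(2)[OF w(1,3)]
    \<comment> \<open>The witness is the disjunct realized at a successor \<open>v\<close> where the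
      instance of the variable holds; transitivity makes it accessible in the model on
      \<open>W\<close>.\<close>
    have "\<exists>\<chi>\<in>W. theta_dia n \<chi> \<subseteq> theta_dia n \<psi> \<and> i \<in> theta n \<chi>" if i: "i \<in> theta_dia n \<psi>" for i
    proof -
      obtain v where v: "i \<in> {1..n}" "v \<in> worlds ?C" "acc ?C w v" "sat ?C v (\<sigma> i)"
        using i td by blast
      obtain k where k: "k \<in> I \<union> J" "sat ?C v (subst \<sigma> (\<phi> k))"
        using cover[OF s4_model_canonical v(2)] by blast
      have "\<phi> k \<in> W" by (rule W_I[OF Th[OF k(1)] s4_model_canonical v(2) k(2)])
      moreover have "i \<in> theta n (\<phi> k)" using theta_of_sat_subst(1)[OF Th[OF k(1)] k(2)] v by simp
      moreover have "theta_dia n (\<phi> k) \<subseteq> theta_dia n \<psi>"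
        unfolding td theta_of_sat_subst(2)[OF Th[OF k(1)] k(2)]
        using s4_model_trans[OF s4_model_canonical w(2) v(2) _ v(3)] by blast
      ultimately show ?thesis by blast
    qed
    \<comment> \<open>Reflexivity gives the converse inclusion: what holds at an accessible member
      of \<open>W\<close> is possible there, hence possible at \<open>\<psi>\<close>.\<close>
    moreover have "theta n \<chi> \<subseteq> theta_dia n \<chi>" if \<chi>W: "\<chi> \<in> W" for \<chi>
    proof -
      obtain w where w: "\<chi> \<in> Theta n" "w \<in> worlds ?C" "sat ?C w (subst \<sigma> \<chi>)"
        using \<chi>W unfolding W_def by blast
      show ?thesis
        unfolding theta_of_sat_subst[OF w(1,3)] using s4_model_refl[OF s4_model_canonical w(2)] w(2) by blast
    qed
    ultimately have "theta_dia n \<psi> = {i \<in> {1..n}. \<exists>\<chi>\<in>W. theta_dia n \<chi> \<subseteq> theta_dia n \<psi> \<and> i \<in> theta n \<chi>}"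
      using theta_dia_subset[of n \<psi>] by blast
    then show ?thesis
      unfolding sat_Theta[OF w(1)] model_Theta_def kripke_model.simps using theta_subset[of n \<psi>] by blast
  qed
  moreover have "\<exists>\<psi> \<in> W. theta_dia n \<psi> = theta n \<psi> \<union> (\<Union>\<chi>\<in>D. theta_dia n \<chi>)" if D: "D \<subseteq> W" for D
  proof -
    \<comment> \<open>The disjunct realized at a root below \<open>D\<close> is the element required
      by (3).\<close>
    obtain N :: "fm set option kripke_model" and r where N: "s4_model N" "r \<in> worlds N"
      "\<And>\<psi>. \<psi> \<in> Theta n \<Longrightarrow> sat N r (subst \<sigma> \<psi>) \<Longrightarrow>
        theta_dia n \<psi> = theta n \<psi> \<union> (\<Union>\<chi>\<in>D. theta_dia n \<chi>)"
      by (rule realized_root_extension[OF s4_model_canonical, of D n \<sigma>]) (use D W_def in auto)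
    obtain i where i: "i \<in> I \<union> J" "sat N r (subst \<sigma> (\<phi> i))" using cover[OF N(1,2)] by blast
    show ?thesis
      using W_I[OF Th[OF i(1)] N(1,2) i(2)] N(3)[OF Th[OF i(1)] i(2)] by (intro bexI[of _ "\<phi> i"])
  qed
  ultimately show ?thesis using sub by blast
qed

section \<open>From W to a rejecting substitution\<close>

text \<open>The set \<open>U w\<close> of the overview. Only witnesses at worlds satisfying
  \<open>Box \<alpha>\<close> count, since the values there survive every later repair.\<close>

definition forced :: "nat \<Rightarrow> fm \<Rightarrow> 'w kripke_model \<Rightarrow> 'w \<Rightarrow> nat set" where
  "forced n \<alpha> M w = {j \<in> {1..n}. \<exists>v\<in>worlds M. acc M w v \<and> sat M v (Box \<alpha>) \<and> val M v j}"

lemma forced_subset: "forced n \<alpha> M w \<subseteq> {1..n}"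
  unfolding forced_def by blast

text \<open>The second alternative is a case distinction on the forced set, written as a formula:
  \<open>subseqs\<close> enumerates the possible sets \<open>U\<close>, the conjunction for
  \<open>U\<close> says that the forced set is exactly \<open>U\<close>, and the filter keeps those
  \<open>U\<close> for which \<open>g U\<close> makes variable \<open>i\<close> true.\<close>

definition repair :: "nat \<Rightarrow> fm \<Rightarrow> (nat set \<Rightarrow> fm) \<Rightarrow> nat \<Rightarrow> fm" where
  "repair n \<alpha> g i = Or (And (Box \<alpha>) (Var i)) (And (Neg (Box \<alpha>))
     (BigOr (map (\<lambda>U. BigAnd (map (\<lambda>j. signed (Dia (And (Box \<alpha>) (Var j))) (of_bool (j \<in> U))) [1..<Suc n]))
       (filter (\<lambda>U. i \<in> theta n (g U)) (map set (subseqs [1..<Suc n]))))))"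

lemma sat_repair:
  "sat M w (repair n \<alpha> g i) \<longleftrightarrow>
    (if sat M w (Box \<alpha>) then val M w i else i \<in> theta n (g (forced n \<alpha> M w)))"
proof -
  have state: "sat M w (BigAnd (map (\<lambda>j. signed (Dia (And (Box \<alpha>) (Var j))) (of_bool (j \<in> U))) [1..<Suc n]))
      \<longleftrightarrow> forced n \<alpha> M w = U" if "U \<in> Pow {1..n}" for U
  proof -
    have "sat M w (BigAnd (map (\<lambda>j. signed (Dia (And (Box \<alpha>) (Var j))) (of_bool (j \<in> U))) [1..<Suc n]))
      \<longleftrightarrow> (\<forall>j\<in>{1..n}. j \<in> U \<longleftrightarrow> (\<exists>v\<in>worlds M. acc M w v \<and> sat M v (Box \<alpha>) \<and> val M v j))"
      by (simp add: sat_BigAnd sat_signed set_upt_Suc del: upt_Suc set_upt) blast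
    then show ?thesis using that by (auto simp: forced_def)
  qed
  have "set ` set (subseqs [1..<Suc n]) = Pow {1..n}"
    by (simp only: subseqs_powset set_upt_Suc)
  then have "sat M w (BigOr (map (\<lambda>U. BigAnd (map (\<lambda>j. signed (Dia (And (Box \<alpha>) (Var j))) (of_bool (j \<in> U))) [1..<Suc n]))
       (filter (\<lambda>U. i \<in> theta n (g U)) (map set (subseqs [1..<Suc n])))))
     \<longleftrightarrow> (\<exists>U\<in>Pow {1..n}. i \<in> theta n (g U) \<and> forced n \<alpha> M w = U)"
    using state by (simp only: sat_BigOr set_map set_filter) (auto simp del: upt_Suc)
  moreover have "forced n \<alpha> M w \<in> Pow {1..n}" using forced_subset by (rule PowI)
  ultimately show ?thesis by (auto simp: repair_def simp del: upt_Suc)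
qed

section \<open>Persistence of truth under the repair substitution\<close>

lemma sat_Box_mono:
  "s4_model M \<Longrightarrow> w \<in> worlds M \<Longrightarrow> v \<in> worlds M \<Longrightarrow> acc M w v \<Longrightarrow> sat M w (Box A) \<Longrightarrow> sat M v (Box A)"
  using s4_model_trans[of M w v] by auto

lemma sat_Box_refl: "s4_model M \<Longrightarrow> w \<in> worlds M \<Longrightarrow> sat M w (Box A) \<Longrightarrow> sat M w A"
  by (auto dest: s4_model_refl)

text \<open>A world satisfying \<open>Box \<alpha>\<close> sees only such worlds, and at all of them
  the repair keeps the variables.\<close>

lemma sat_repair_model_Box:
  assumes M: "s4_model M"
  shows "w \<in> worlds M \<Longrightarrow> sat M w (Box \<alpha>) \<Longrightarrow> sat (subst_model M (repair n \<alpha> g)) w A = sat M w A"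
proof (induction A arbitrary: w)
  case (Box A)
  have "sat (subst_model M (repair n \<alpha> g)) v A = sat M v A" if "v \<in> worlds M" "acc M w v" for v
    using Box.IH[OF that(1)] sat_Box_mono[OF M Box.prems(1) that Box.prems(2)] by blast
  then show ?case by auto
qed (auto simp: sat_repair simp del: sat.simps(4))

lemma forced_antimono:
  assumes "s4_model M" "w \<in> worlds M" "v \<in> worlds M" "acc M w v"
  shows "forced n \<alpha> M v \<subseteq> forced n \<alpha> M w"
  unfolding forced_def using s4_model_trans[OF assms(1-3) _ assms(4)] by blast

lemma forced_repair:
  assumes "s4_model M"
  shows "forced n \<alpha> M w \<subseteq> forced n \<alpha> (subst_model M (repair n \<alpha> g)) w"
  unfolding forced_def
  using sat_repair_model_Box[OF assms, of _ \<alpha> n g "Box \<alpha>"] sat_repair_model_Box[OF assms, of _ \<alpha> n g "Var _"]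
  by (auto simp del: sat.simps(4))

text \<open>Condition (3) with the choice made. \<open>g\<close> depends on the union alone, so the
  repair can compute its value from the forced set without knowing \<open>D\<close>. The members of
  \<open>W\<close> are listed so that their disjunction is a formula.\<close>

locale extension_choice =
  fixes n :: nat and ws :: "fm list" and g :: "nat set \<Rightarrow> fm"
  assumes ws_Theta: "set ws \<subseteq> Theta n"
    and g_mem: "\<And>D. D \<subseteq> set ws \<Longrightarrow> g (\<Union>\<chi>\<in>D. theta_dia n \<chi>) \<in> set ws"
    and g_dia: "\<And>D. D \<subseteq> set ws \<Longrightarrow> theta_dia n (g (\<Union>\<chi>\<in>D. theta_dia n \<chi>)) =
      theta n (g (\<Union>\<chi>\<in>D. theta_dia n \<chi>)) \<union> (\<Union>\<chi>\<in>D. theta_dia n \<chi>)"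
begin

abbreviation W :: "fm set" where "W \<equiv> set ws"

definition \<alpha> :: fm where "\<alpha> = BigOr ws"

lemma sat_alpha: "sat M w \<alpha> \<longleftrightarrow> (\<exists>\<psi>\<in>W. sat M w \<psi>)"
  by (simp add: \<alpha>_def sat_BigOr)

text \<open>Shows that \<open>g\<close> is always applied to a union covered by (3). For
  \<open>D\<close> take the members of \<open>W\<close> true at worlds above \<open>w\<close>
  satisfying \<open>Box \<alpha>\<close>; each such world satisfies some member of \<open>W\<close>,
  whose \<open>theta_dia\<close> lists what is possible from there.\<close>

lemma forced_eq_Union:
  fixes M :: "'w kripke_model"
  assumes M: "s4_model M" and w: "w \<in> worlds M"
  shows "\<exists>D\<subseteq>W. forced n \<alpha> M w = (\<Union>\<chi>\<in>D. theta_dia n \<chi>)"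
proof -
  let ?D = "{\<chi> \<in> W. \<exists>v\<in>worlds M. acc M w v \<and> sat M v (Box \<alpha>) \<and> sat M v \<chi>}"
  have "j \<in> forced n \<alpha> M w \<longleftrightarrow> j \<in> (\<Union>\<chi>\<in>?D. theta_dia n \<chi>)" for j
  proof
    assume "j \<in> forced n \<alpha> M w"
    then obtain v where v: "j \<in> {1..n}" "v \<in> worlds M" "acc M w v" "sat M v (Box \<alpha>)" "val M v j"
      unfolding forced_def by blast
    obtain \<chi> where \<chi>: "\<chi> \<in> W" "sat M v \<chi>"
      using sat_Box_refl[OF M v(2,4)] unfolding sat_alpha by blast
    have "\<chi> \<in> Theta n" using \<chi>(1) ws_Theta by blast
    from theta_of_sat(2)[OF this \<chi>(2)] have "j \<in> theta_dia n \<chi>"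
      using v s4_model_refl[OF M v(2)] by blast
    moreover have "\<chi> \<in> ?D" using \<chi> v by blast
    ultimately show "j \<in> (\<Union>\<chi>\<in>?D. theta_dia n \<chi>)" by (rule UN_I[rotated])
  next
    assume "j \<in> (\<Union>\<chi>\<in>?D. theta_dia n \<chi>)"
    then obtain \<chi> v where \<chi>: "\<chi> \<in> W" "sat M v \<chi>" "j \<in> theta_dia n \<chi>"
      and v: "v \<in> worlds M" "acc M w v" "sat M v (Box \<alpha>)" by blast
    have "\<chi> \<in> Theta n" using \<chi>(1) ws_Theta by blast
    from theta_of_sat(2)[OF this \<chi>(2)] obtain u
      where u: "j \<in> {1..n}" "u \<in> worlds M" "acc M v u" "val M u j"
      using \<chi>(3) by blast
    moreover have "sat M u (Box \<alpha>)" by (rule sat_Box_mono[OF M v(1) u(2,3) v(3)])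
    moreover have "acc M w u" by (rule s4_model_trans[OF M w v(1) u(2) v(2) u(3)])
    ultimately show "j \<in> forced n \<alpha> M w" unfolding forced_def by blast
  qed
  then have "forced n \<alpha> M w = (\<Union>\<chi>\<in>?D. theta_dia n \<chi>)" by (rule set_eqI)
  moreover have "?D \<subseteq> W" by blast
  ultimately show ?thesis by blast
qed

text \<open>All worlds above \<open>w\<close> that refute \<open>Box \<alpha>\<close> receive the
  valuation of one disjunct \<open>g U\<close>. From any of them the possible variables are then
  those of \<open>g U\<close> together with \<open>U\<close>, which by the choice of
  \<open>g\<close> is \<open>theta_dia n (g U)\<close>; so \<open>g U\<close> becomes true
  there.\<close>

lemma repair_sat_Box:
  fixes M :: "'w kripke_model"
  assumes M: "s4_model M" and w: "w \<in> worlds M"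
    and const: "\<And>v. v \<in> worlds M \<Longrightarrow> acc M w v \<Longrightarrow> \<not> sat M v (Box \<alpha>) \<Longrightarrow>
      forced n \<alpha> M v = forced n \<alpha> M w"
  shows "sat (subst_model M (repair n \<alpha> g)) w (Box \<alpha>)"
proof -
  let ?M = "subst_model M (repair n \<alpha> g)"
  define U where "U = forced n \<alpha> M w"
  obtain D where "D \<subseteq> W" "U = (\<Union>\<chi>\<in>D. theta_dia n \<chi>)"
    using forced_eq_Union[OF M w] unfolding U_def by blast
  then have gU: "g U \<in> W" "theta_dia n (g U) = theta n (g U) \<union> U" using g_mem g_dia by blast+
  have "sat ?M v \<alpha>" if v: "v \<in> worlds M" "acc M w v" for v
  proof (cases "sat M v (Box \<alpha>)")
    case True
    then show ?thesis
      using sat_repair_model_Box[OF M v(1) True] sat_Box_refl[OF M v(1)] by blast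
  next
    case False
    have Uv: "forced n \<alpha> M v = U" using const[OF v False] U_def by simp
    \<comment> \<open>Above \<open>v\<close> a world either keeps its old valuation or gets that of
      \<open>g U\<close>; no third valuation arises.\<close>
    have val_u: "val ?M u i \<longleftrightarrow> (if sat M u (Box \<alpha>) then val M u i else i \<in> theta n (g U))"
      if "u \<in> worlds M" "acc M v u" for u i
      using const[OF that(1) s4_model_trans[OF M w v(1) that(1) v(2) that(2)]] U_def
      by (simp add: sat_repair del: sat.simps(4))
    have val_v: "val ?M v i \<longleftrightarrow> i \<in> theta n (g U)" for i
      using val_u[OF v(1) s4_model_refl[OF M v(1)]] by (simp only: False if_False)
    have ex_val: "(\<exists>u\<in>worlds ?M. acc ?M v u \<and> val ?M u i) \<longleftrightarrow> i \<in> theta n (g U) \<union> U"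
      if i: "i \<in> {1..n}" for i
    proof
      assume "\<exists>u\<in>worlds ?M. acc ?M v u \<and> val ?M u i"
      then obtain u where u: "u \<in> worlds M" "acc M v u" "val ?M u i" by auto
      then show "i \<in> theta n (g U) \<union> U"
        using val_u[OF u(1,2), of i] i unfolding Uv[symmetric] forced_def
        by (auto split: if_splits simp del: sat.simps(4) subst_model_simps(3))
    next
      assume "i \<in> theta n (g U) \<union> U"
      then show "\<exists>u\<in>worlds ?M. acc ?M v u \<and> val ?M u i"
      proof
        assume "i \<in> theta n (g U)"
        then have "val ?M v i" by (simp only: val_v)
        moreover have "v \<in> worlds ?M" "acc ?M v v" using v(1) s4_model_refl[OF M v(1)] by simp_all
        ultimately show ?thesis by blast
      next
        assume "i \<in> U"
        then obtain u where u: "u \<in> worlds M" "acc M v u" "sat M u (Box \<alpha>)" "val M u i"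
          unfolding Uv[symmetric] forced_def by blast
        then show ?thesis using val_u[OF u(1,2), of i] by auto
      qed
    qed
    have "theta n (g U) = {i \<in> {1..n}. val ?M v i}"
      unfolding val_v using theta_subset[of n "g U"] by blast
    moreover have "theta_dia n (g U) = {i \<in> {1..n}. \<exists>u\<in>worlds ?M. acc ?M v u \<and> val ?M u i}"
      using ex_val theta_dia_subset[of n "g U"] unfolding gU(2)[symmetric] by blast
    ultimately have "sat ?M v (g U)" using sat_Theta[of "g U" n ?M v] gU(1) ws_Theta by blast
    then show ?thesis using gU(1) unfolding sat_alpha by blast
  qed
  then show ?thesis by simp
qed

text \<open>Each round a world stays unrepaired is paid for by a strictly smaller forced set at some
  unrepaired world above it, to which the induction hypothesis applies.\<close>

lemma iterated_repair_card:
  fixes M :: "'w kripke_model"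
  assumes "s4_model M"
  defines "N \<equiv> \<lambda>k. ((\<lambda>M. subst_model M (repair n \<alpha> g)) ^^ k) M"
  shows "w \<in> worlds M \<Longrightarrow> \<not> sat (N k) w (Box \<alpha>) \<Longrightarrow> k \<le> card (forced n \<alpha> (N k) w)"
proof (induction k arbitrary: w)
  case (Suc k)
  have N: "s4_model (N k)" "worlds (N k) = worlds M"
    using assms(1) by (simp_all add: N_def)
  have step: "N (Suc k) = subst_model (N k) (repair n \<alpha> g)" by (simp add: N_def)
  have fin: "finite (forced n \<alpha> (N j) v)" for j v
    by (rule finite_subset[OF forced_subset]) simp
  have w: "w \<in> worlds (N k)" using Suc.prems N by blast
  \<comment> \<open>Otherwise \<open>repair_sat_Box\<close> would repair \<open>w\<close> in this
    very round.\<close>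
  have "\<exists>v\<in>worlds (N k). acc (N k) w v \<and> \<not> sat (N k) v (Box \<alpha>) \<and>
      forced n \<alpha> (N k) v \<noteq> forced n \<alpha> (N k) w"
  proof (rule ccontr)
    assume "\<not> ?thesis"
    then have "sat (N (Suc k)) w (Box \<alpha>)"
      unfolding step by (intro repair_sat_Box[OF N(1) w]) blast
    with Suc.prems(2) show False by contradiction
  qed
  then obtain v where v: "v \<in> worlds (N k)" "acc (N k) w v" "\<not> sat (N k) v (Box \<alpha>)"
    "forced n \<alpha> (N k) v \<noteq> forced n \<alpha> (N k) w" by blast
  have "forced n \<alpha> (N k) v \<subset> forced n \<alpha> (N k) w"
    using forced_antimono[OF N(1) w v(1,2)] v(4) by (rule psubsetI)
  then have "card (forced n \<alpha> (N k) v) < card (forced n \<alpha> (N k) w)"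
    by (rule psubset_card_mono[OF fin])
  moreover have "k \<le> card (forced n \<alpha> (N k) v)" using v(1) N(2) by (intro Suc.IH v(3)) simp
  ultimately have "Suc k \<le> card (forced n \<alpha> (N k) w)"
    by linarith
  \<comment> \<open>The bound was reached for round \<open>k\<close>; forced sets only grow on
    passing to the next round.\<close>
  also have "\<dots> \<le> card (forced n \<alpha> (N (Suc k)) w)"
    by (rule card_mono[OF fin]) (unfold step, rule forced_repair[OF N(1)])
  finally show ?case .
qed simp

lemma iterated_repair_valid:
  fixes M :: "'w kripke_model"
  assumes "s4_model M" "w \<in> worlds M"
  shows "sat (((\<lambda>M. subst_model M (repair n \<alpha> g)) ^^ Suc n) M) w \<alpha>"
proof -
  let ?N = "((\<lambda>M. subst_model M (repair n \<alpha> g)) ^^ Suc n) M"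
  have "sat ?N w (Box \<alpha>)"
  proof (rule ccontr)
    assume "\<not> sat ?N w (Box \<alpha>)"
    \<comment> \<open>Forced sets have at most \<open>n\<close> elements, so one round more than
      \<open>n\<close> suffices.\<close>
    then have "Suc n \<le> card (forced n \<alpha> ?N w)" by (rule iterated_repair_card[OF assms])
    also have "\<dots> \<le> card {1..n}" by (rule card_mono[OF _ forced_subset]) simp
    finally show False by simp
  qed
  then show ?thesis
    by (rule sat_Box_refl[rotated 2]) (simp_all add: assms del: funpow.simps)
qed

end

primrec subst_iter :: "(nat \<Rightarrow> fm) \<Rightarrow> nat \<Rightarrow> nat \<Rightarrow> fm" where
  "subst_iter \<sigma> 0 = Var"
| "subst_iter \<sigma> (Suc k) = (\<lambda>i. subst (subst_iter \<sigma> k) (\<sigma> i))"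

text \<open>Turns the repeated change of models into a single substitution. The new
  \<open>\<sigma>\<close> is the inner formula, so it is evaluated in the model reached after
  \<open>k\<close> rounds.\<close>

lemma subst_model_iter: "subst_model M (subst_iter \<sigma> k) = ((\<lambda>M. subst_model M \<sigma>) ^^ k) M"
proof (induction k)
  case 0
  show ?case by (simp add: subst_model_def)
next
  case (Suc k)
  have "subst_model M (subst_iter \<sigma> (Suc k)) = subst_model (subst_model M (subst_iter \<sigma> k)) \<sigma>"
    by (simp add: subst_model_def sat_subst[unfolded subst_model_def])
  then show ?case by (simp add: Suc.IH)
qed

lemma sat_iterated_repair_Box:
  assumes "s4_model M" "w \<in> worlds M" "sat M w (Box \<alpha>)"
  shows "sat (((\<lambda>M. subst_model M (repair n \<alpha> g)) ^^ k) M) w A = sat M w A"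
proof (induction k arbitrary: A)
  case (Suc k)
  let ?N = "((\<lambda>M. subst_model M (repair n \<alpha> g)) ^^ k) M"
  have N: "s4_model ?N" "worlds ?N = worlds M" using assms(1) by simp_all
  \<comment> \<open>The induction ranges over all formulas, so it covers \<open>Box \<alpha>\<close>
    itself and the one-round lemma applies again.\<close>
  have "sat ?N w (Box \<alpha>)" using assms(3) by (simp only: Suc.IH)
  then show ?case using sat_repair_model_Box[OF N(1)] N(2) assms(2) Suc.IH by simp
qed simp

lemma criterion_imp_inadmissible:
  assumes enum: "bij_betw \<phi> {1..s} (Theta n)"
    and I: "I \<subseteq> {1..s}" and J: "J \<subseteq> {1..s}"
    and WIJ: "W \<subseteq> {\<phi> i | i. i \<in> I \<union> J}" and i: "i \<in> I - J" "\<phi> i \<in> W"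
    and self [rule_format]: "\<forall>\<psi> \<in> W. sat (model_Theta n W) \<psi> \<psi>"
    and ext [rule_format]: "\<forall>D. D \<subseteq> W \<longrightarrow>
      (\<exists>\<psi> \<in> W. theta_dia n \<psi> = theta n \<psi> \<union> (\<Union>\<chi>\<in>D. theta_dia n \<chi>))"
  shows "inadmissible (rule_IJ \<phi> I J)"
proof -
  have fin: "finite I" "finite J" using I J finite_subset by blast+
  have Th: "\<phi> i \<in> Theta n" if "i \<in> I \<union> J" for i
    using enum that I J by (auto simp: bij_betw_def)
  have WT: "W \<subseteq> Theta n" using WIJ Th by blast
  have "finite {\<phi> i | i. i \<in> I \<union> J}" using fin by simp
  then obtain ws where ws: "set ws = W" using finite_list[OF finite_subset[OF WIJ]] by blast
  define g where "g U = (SOME \<psi>. \<psi> \<in> W \<and> theta_dia n \<psi> = theta n \<psi> \<union> U)" for U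
  have g: "g (\<Union>\<chi>\<in>D. theta_dia n \<chi>) \<in> W \<and> theta_dia n (g (\<Union>\<chi>\<in>D. theta_dia n \<chi>)) =
      theta n (g (\<Union>\<chi>\<in>D. theta_dia n \<chi>)) \<union> (\<Union>\<chi>\<in>D. theta_dia n \<chi>)" if "D \<subseteq> W" for D
    unfolding g_def by (rule someI_ex[OF ext[OF that, unfolded Bex_def]])
  interpret extension_choice n ws g
  proof
    show "set ws \<subseteq> Theta n" using WT by (simp only: ws)
  next
    fix D assume "D \<subseteq> set ws"
    then have "D \<subseteq> W" by (simp only: ws)
    note * = g[OF this]
    show "g (\<Union>\<chi>\<in>D. theta_dia n \<chi>) \<in> set ws" using * unfolding ws by (rule conjunct1)
    show "theta_dia n (g (\<Union>\<chi>\<in>D. theta_dia n \<chi>)) =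
      theta n (g (\<Union>\<chi>\<in>D. theta_dia n \<chi>)) \<union> (\<Union>\<chi>\<in>D. theta_dia n \<chi>)"
      using * by (rule conjunct2)
  qed
  note sat_alpha = sat_alpha[unfolded ws]
  define \<tau> where "\<tau> = subst_iter (repair n \<alpha> g) (Suc n)"
  have "\<turnstile>\<^sub>S\<^sub>4 subst \<tau> (Or (disj_over \<phi> I) (disj_over \<phi> J))"
  proof (rule S4_complete)
    fix w assume "w \<in> worlds canonical"
    then have "sat (subst_model canonical \<tau>) w \<alpha>"
      unfolding \<tau>_def subst_model_iter by (rule iterated_repair_valid[OF s4_model_canonical])
    then obtain \<psi> where "\<psi> \<in> W" "sat (subst_model canonical \<tau>) w \<psi>"
      unfolding sat_alpha by blast
    then show "sat canonical w (subst \<tau> (Or (disj_over \<phi> I) (disj_over \<phi> J)))"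
      using WIJ fin unfolding sat_subst by (auto simp: sat_disj_over)
  qed
  moreover have "\<not> \<turnstile>\<^sub>S\<^sub>4 subst \<tau> (disj_over \<phi> J)"
  proof
    let ?M = "model_Theta n W"
    assume "\<turnstile>\<^sub>S\<^sub>4 subst \<tau> (disj_over \<phi> J)"
    moreover have M: "s4_model ?M" "\<phi> i \<in> worlds ?M"
      using i(2) by (auto simp: s4_model_def model_Theta_def)
    ultimately have "sat ?M (\<phi> i) (subst \<tau> (disj_over \<phi> J))" by (rule S4_sound)
    \<comment> \<open>By (2) every world of this model satisfies itself, a member of
      \<open>W\<close>, so \<open>\<alpha>\<close> holds everywhere and \<open>\<tau>\<close>
      changes nothing.\<close>
    moreover have "sat ?M (\<phi> i) (Box \<alpha>)" using self by (auto simp: sat_alpha model_Theta_def)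
    ultimately have "sat ?M (\<phi> i) (disj_over \<phi> J)"
      unfolding sat_subst \<tau>_def subst_model_iter by (simp only: sat_iterated_repair_Box[OF M])
    then obtain j where j: "j \<in> J" "sat ?M (\<phi> i) (\<phi> j)" using fin by (auto simp: sat_disj_over)
    \<comment> \<open>The world also satisfies its own disjunct, and only one disjunct can be true
      at a world; injectivity of the enumeration then contradicts the choice of \<open>i\<close>
      outside \<open>J\<close>.\<close>
    have "\<phi> i = \<phi> j"
      by (rule sat_Theta_unique[OF Th Th self[OF i(2)] j(2)]) (use i(1) j(1) in blast)+
    moreover have "i \<in> {1..s}" "j \<in> {1..s}" using i(1) j(1) I J by blast+
    ultimately have "i = j" by (rule inj_onD[OF bij_betw_imp_inj_on[OF enum]])
    then show False using i(1) j(1) by blast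
  qed
  ultimately show ?thesis unfolding inadmissible_def admissible_def rule_IJ_def by auto
qed

theorem theorem3p6:
  fixes n s :: nat and \<phi> :: "nat \<Rightarrow> fm" and I J :: "nat set"
  assumes enum: "bij_betw \<phi> {1..s} (Theta n)"
    and I: "I \<subseteq> {1..s}" and J: "J \<subseteq> {1..s}"
  shows "inadmissible (rule_IJ \<phi> I J) \<longleftrightarrow>
    (\<exists>W. W \<subseteq> {\<phi> i | i. i \<in> I \<union> J} \<and>
       (\<exists>i \<in> I - J. \<phi> i \<in> W) \<and>
       (\<forall>\<psi> \<in> W. sat (model_Theta n W) \<psi> \<psi>) \<and>
       (\<forall>D. D \<subseteq> W \<longrightarrow>
          (\<exists>\<psi> \<in> W. theta_dia n \<psi> = theta n \<psi> \<union> (\<Union>\<chi>\<in>D. theta_dia n \<chi>))))"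
proof
  assume "inadmissible (rule_IJ \<phi> I J)"
  then obtain \<sigma> where "rejects \<sigma> (rule_IJ \<phi> I J)"
    unfolding inadmissible_def admissible_def by blast
  then show "\<exists>W. W \<subseteq> {\<phi> i | i. i \<in> I \<union> J} \<and>
       (\<exists>i \<in> I - J. \<phi> i \<in> W) \<and>
       (\<forall>\<psi> \<in> W. sat (model_Theta n W) \<psi> \<psi>) \<and>
       (\<forall>D. D \<subseteq> W \<longrightarrow>
          (\<exists>\<psi> \<in> W. theta_dia n \<psi> = theta n \<psi> \<union> (\<Union>\<chi>\<in>D. theta_dia n \<chi>)))"
    by (rule rejects_imp_criterion[OF enum I J])
next
  assume "\<exists>W. W \<subseteq> {\<phi> i | i. i \<in> I \<union> J} \<and>
       (\<exists>i \<in> I - J. \<phi> i \<in> W) \<and>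
       (\<forall>\<psi> \<in> W. sat (model_Theta n W) \<psi> \<psi>) \<and>
       (\<forall>D. D \<subseteq> W \<longrightarrow>
          (\<exists>\<psi> \<in> W. theta_dia n \<psi> = theta n \<psi> \<union> (\<Union>\<chi>\<in>D. theta_dia n \<chi>)))"
  then show "inadmissible (rule_IJ \<phi> I J)"
    by (elim exE conjE bexE) (rule criterion_imp_inadmissible[OF enum I J])
qed

end
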